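(* Let $r\ge 1$ and $\lambda\ge 0$ be integers, and let $H$ be an $r$-uniform hypergraph on $n>10r^3$ vertices in which all codegrees are equal to $\lambda$. Then for every weighting $w: V(H)\to\mathbb{R}$ with $\sum_{v\in V(H)} w(v)\ge 0$, we have $e^{+}(H)\ge \delta(H)$. Moreover, in the case of equality $e^{+}(H)=\delta(H)$, all nonnegative edges form a star, i.e., there is a fixed vertex of $H$ contained in every nonnegative edge.
   Context: An $r$-uniform hypergraph $H$ consists of a finite vertex set $V(H)$ and a family of edges, each an $r$-element subset of $V(H)$. The degree of a vertex is the number of edges containing it; $\delta(H)$ is the minimum degree. The codegree of a pair of distinct vertices is the number of edges containing both of them. Given a weighting $w:V(H)\to\mathbb{R}$, an edge $e$ is nonnegative if $\sum_{v\in e} w(v)\ge 0$, and $e^{+}(H)$ denotes the number of nonnegative edges. *)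

theory Defs
  imports Complex_Main
begin

definition uniform_hypergraph :: "nat \<Rightarrow> 'a set \<Rightarrow> 'a set set \<Rightarrow> bool" where
  "uniform_hypergraph r V E \<longleftrightarrow> finite V \<and> (\<forall>e\<in>E. e \<subseteq> V \<and> card e = r)"

definition degree :: "'a set set \<Rightarrow> 'a \<Rightarrow> nat" where
  "degree E v = card {e \<in> E. v \<in> e}"

text \<open>Meaningful only for a finite nonempty vertex set, since \<^const>\<open>Min\<close> is unspecified on
  the empty set.\<close>

definition min_degree :: "'a set \<Rightarrow> 'a set set \<Rightarrow> nat" where
  "min_degree V E = Min (degree E ` V)"

definition codegree :: "'a set set \<Rightarrow> 'a \<Rightarrow> 'a \<Rightarrow> nat" where
  "codegree E u v = card {e \<in> E. u \<in> e \<and> v \<in> e}"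

definition nonneg_edges :: "'a set set \<Rightarrow> ('a \<Rightarrow> real) \<Rightarrow> 'a set set" where
  "nonneg_edges E w = {e \<in> E. (\<Sum>v\<in>e. w v) \<ge> 0}"

end

theory Submission
  imports Defs
begin

text \<open>Equal codegrees make \<open>H\<close> regular, of degree \<open>d\<close> say, and give
  \<open>(\<Sum>f\<ni>v. w f) = (d - lam) * w v + lam * (\<Sum>u. w u)\<close>. Let \<open>v\<close> be a heaviest vertex. If all edges at \<open>v\<close>
  are nonnegative, there are at least \<open>d\<close> of them, and equality forces a star. Otherwise \<open>v\<close> lies
  on a negative edge \<open>e\<close>; suppose that there are still at most \<open>d\<close> nonnegative edges. Two edges
  rarely share two given vertices, so the total weight of the \<open>4r\<close> heaviest vertices is only a
  constant multiple of \<open>w v\<close>; hence nearly all vertices weigh less than \<open>O(w v / r)\<close>, and a constant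
  proportion of the edges at \<open>v\<close> is nonnegative. The same argument off \<open>e\<close>, where the total
  weight is positive, gives a heaviest vertex \<open>x\<close> there with many nonnegative edges avoiding
  \<open>e\<close>. If \<open>x\<close> lies on a negative edge \<open>g\<close> disjoint from \<open>e\<close>, repeat off \<open>e \<union> g\<close>. The
  proportions \<open>0.49 + 0.357 + 0.224\<close> add up to more than \<open>1\<close>.\<close>

section \<open>Selecting heaviest elements, and numerical estimates\<close>

lemma top_subset:
  fixes g :: "'a \<Rightarrow> 'b::linorder"
  assumes "finite A" "k \<le> card A"
  shows "\<exists>T\<subseteq>A. card T = k \<and> (\<forall>t\<in>T. \<forall>a\<in>A - T. g a \<le> g t)"
  using assms(2)
proof (induction k)
  case 0
  then show ?case by (intro exI[of _ "{}"]) auto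
next
  case (Suc k)
  then obtain T where T: "T \<subseteq> A" "card T = k" "\<forall>t\<in>T. \<forall>a\<in>A - T. g a \<le> g t"
    using Suc_leD by blast
  have fin: "finite T" "finite (A - T)"
    using assms(1) T(1) finite_subset by auto
  have "A - T \<noteq> {}"
    using T(1,2) Suc.prems by auto
  then obtain a where a: "a \<in> A - T" "\<forall>b\<in>A - T. g b \<le> g a"
    using obtains_MAX[OF fin(2), of g] fin(2) by (metis Max_ge finite_imageI imageI)
  show ?case
    by (rule exI[of _ "insert a T"]) (use T a fin in auto)
qed

text \<open>The hypothesis \<open>dl\<close> is how the size condition \<open>n > 10 * r^3\<close>
  enters all estimates: it combines with \<open>d * (r - 1) = l * (n - 1)\<close>.\<close>

lemma codegree_small:
  fixes r d l :: real
  assumes r: "r \<ge> 2" and d: "d > 0" and dl: "10 * l * r^3 \<le> d * (r - 1)"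
  shows "l \<le> 3/200 * d" and "l * r \<le> d / 40" and "4 * r * l \<le> d * (r - 1) / 10"
proof -
  have r3: "r^3 > 0" using r by simp
  \<comment> \<open>The product expands to \<open>r^3 - 12 * r + 16\<close>: the cubic lies above
    its tangent at \<open>2\<close>.\<close>
  have "0 \<le> (r - 2)^2 * (r + 4)" using r by simp
  then have "r - 1 \<le> 3/20 * r^3"
    using r by (simp add: power2_eq_square power3_eq_cube algebra_simps)
  then have "d * (r - 1) \<le> d * (3/20 * r^3)"
    using d by (intro mult_left_mono) auto
  with dl have "l * r^3 \<le> (3/200 * d) * r^3" by simp
  then show "l \<le> 3/200 * d" using r3 by simp
  have "0 \<le> (r - 2)^2" by simp
  then have "r - 1 \<le> r^2 / 4" by (simp add: power2_eq_square algebra_simps)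
  then have "d * (r - 1) \<le> d * (r^2 / 4)"
    using d by (intro mult_left_mono) auto
  with dl have "(l * r) * r^2 \<le> (d / 40) * r^2" by (simp add: power2_eq_square power3_eq_cube)
  then show "l * r \<le> d / 40" using r by simp
  have "4 \<le> r^2" using power_mono[OF r, of 2] by simp
  then have "d * (r - 1) / 10 * 4 \<le> d * (r - 1) / 10 * r^2"
    using d r by (intro mult_left_mono) auto
  with dl have "(4 * r * l) * r^2 \<le> (d * (r - 1) / 10) * r^2"
    unfolding power2_eq_square power3_eq_cube by argo
  then show "4 * r * l \<le> d * (r - 1) / 10" using r by simp
qed

text \<open>Here \<open>X\<close> is the positive weight of the \<open>4 * r\<close> heaviest vertices, \<open>th\<close> bounds all other
  weights, \<open>mu\<close> is the maximum weight, and \<open>c \<le> u * r\<close> is the number of deleted vertices. Since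
  \<open>th \<le> X / (4 * r)\<close>, the bound on \<open>X\<close> in terms of \<open>mu + (r - 1) * th\<close> is self-improving: it
  yields \<open>mu + (r - 1) * th \<le> mu / (1 - al)\<close> with \<open>al = 9/20 + u/10\<close>, where \<open>9/20 = 1/4 + 4/20\<close>
  comes from the choice of \<open>4 * r\<close> vertices.\<close>

lemma concentration_arith:
  fixes r d l u mu th X Q p c :: real
  assumes r: "r \<ge> 2" and d: "d > 0" and l: "l \<ge> 0" and dl: "10 * l * r^3 \<le> d * (r - 1)"
    and u: "0 \<le> u" "u \<le> 2" and c: "c \<le> u * r"
    and mu: "mu > 0" and th: "th \<ge> 0" "4 * r * th \<le> X"
    and Q: "Q \<le> d + l * r^2 * (8 + 4 * u)"
    and X: "(d - l - 4 * r * l) * X \<le> Q * (mu + (r - 1) * th)"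
    and p: "0 \<le> p + l * c" "(d - l) * mu - l * X \<le> (p + l * c) * (mu + (r - 1) * th)"
  shows "(49/100 - 133/1000 * u) * d \<le> p"
proof -
  define al where "al = 9/20 + u/10"
  define G where "G = d - l - 4 * r * l"
  define t where "t = (r - 1) * th"
  define Q0 where "Q0 = d + l * r^2 * (8 + 4 * u)"
  have al: "0 < al" "al < 1" using u by (auto simp: al_def)
  have t0: "t \<ge> 0" using r th by (simp add: t_def)
  \<comment> \<open>Once \<open>G > 0\<close> is known, this bounds the contraction factor
    \<open>(r - 1) * Q0 / (4 * r * G)\<close> of the self-improving bound by \<open>al\<close>. The
    extra factor \<open>r - 1\<close> lets \<open>dl\<close> replace \<open>d * (r - 1)\<close> by
    \<open>10 * l * r^3\<close>, which leaves a polynomial in \<open>r\<close> and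
    \<open>u\<close>.\<close>
  have key: "(r - 1) * Q0 \<le> 4 * r * al * G"
  proof -
    have "(r - 1) * (4 * r * al * G - (r - 1) * Q0) =
        (d * (r - 1)) * (4 * r * al - (r - 1))
        - l * ((r - 1) * (4 * r * al * (1 + 4 * r) + (r - 1) * r^2 * (8 + 4 * u)))"
      by (simp add: G_def Q0_def algebra_simps)
    moreover have "(10 * l * r^3) * (4 * r * al - (r - 1)) \<le> (d * (r - 1)) * (4 * r * al - (r - 1))"
      using dl r u by (intro mult_right_mono) (auto simp: al_def algebra_simps)
    moreover have "(10 * l * r^3) * (4 * r * al - (r - 1))
        - l * ((r - 1) * (4 * r * al * (1 + 4 * r) + (r - 1) * r^2 * (8 + 4 * u))) =
        l * (r * ((94/5 + 32/5 * u) * r^2 - (8 + 4 * u) * r + (9/5 + 2/5 * u) * (3 * r + 1)))"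
      by (simp add: al_def power2_eq_square power3_eq_cube) algebra
    moreover have "(94/5 + 32/5 * u) * r^2 - (8 + 4 * u) * r \<ge> 0"
    proof -
      have "(8 + 4 * u) * r \<le> (94/5 + 32/5 * u) * r" using r u by (intro mult_right_mono) auto
      also have "\<dots> \<le> (94/5 + 32/5 * u) * r^2"
        using r u by (intro mult_left_mono) (auto simp: power2_eq_square)
      finally show ?thesis by simp
    qed
    ultimately have "(r - 1) * (4 * r * al * G - (r - 1) * Q0) \<ge>
        l * (r * ((94/5 + 32/5 * u) * r^2 - (8 + 4 * u) * r + (9/5 + 2/5 * u) * (3 * r + 1)))"
      by linarith
    moreover have "l * (r * ((94/5 + 32/5 * u) * r^2 - (8 + 4 * u) * r
        + (9/5 + 2/5 * u) * (3 * r + 1))) \<ge> 0"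
      using l r u \<open>(94/5 + 32/5 * u) * r^2 - (8 + 4 * u) * r \<ge> 0\<close>
      by (intro mult_nonneg_nonneg add_nonneg_nonneg) auto
    ultimately have "(r - 1) * (4 * r * al * G - (r - 1) * Q0) \<ge> 0" by linarith
    then show ?thesis using r by (simp add: zero_le_mult_iff)
  qed
  have "Q0 > 0"
    unfolding Q0_def using d l u by (intro add_pos_nonneg mult_nonneg_nonneg) auto
  then have "(r - 1) * Q0 > 0" using r by simp
  with key have "4 * r * al * G > 0" by linarith
  moreover have "4 * r * al > 0" using r al by simp
  ultimately have G0: "G > 0" using zero_less_mult_pos by blast
  have XQ: "G * X \<le> Q0 * (mu + t)"
  proof -
    have "Q * (mu + t) \<le> Q0 * (mu + t)"
      using Q mu t0 by (intro mult_right_mono) (auto simp: Q0_def)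
    then show ?thesis using X by (simp add: G_def t_def)
  qed
  have B: "(1 - al) * (mu + t) \<le> mu"
  proof -
    have "(4 * r * G) * t = (r - 1) * (G * (4 * r * th))" by (simp add: t_def algebra_simps)
    also have "\<dots> \<le> (r - 1) * (G * X)"
      using th G0 r by (intro mult_left_mono) auto
    also have "\<dots> \<le> (r - 1) * (Q0 * (mu + t))"
      using XQ r by (intro mult_left_mono) auto
    also have "\<dots> = ((r - 1) * Q0) * (mu + t)" by simp
    also have "\<dots> \<le> (4 * r * al * G) * (mu + t)"
      using key mu t0 by (intro mult_right_mono) auto
    also have "\<dots> = (4 * r * G) * (al * (mu + t))" by simp
    finally have "t \<le> al * (mu + t)"
      using G0 r by (subst (asm) mult_le_cancel_left_pos) auto
    then show ?thesis by (simp add: algebra_simps)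
  qed
  \<comment> \<open>Multiplying by \<open>G * (r - 1)\<close> allows \<open>key\<close> to absorb
    \<open>Q0\<close> a second time.\<close>
  have lX: "(1 - al) * (l * X) \<le> al * d / 10 * mu"
  proof -
    have "(G * (r - 1)) * ((1 - al) * (l * X)) = (r - 1) * l * (1 - al) * (G * X)" by simp
    also have "\<dots> \<le> (r - 1) * l * (1 - al) * (Q0 * (mu + t))"
      using XQ r l al by (intro mult_left_mono) auto
    also have "\<dots> = (r - 1) * l * Q0 * ((1 - al) * (mu + t))" by simp
    also have "\<dots> \<le> (r - 1) * l * Q0 * mu"
      using B r l \<open>Q0 > 0\<close> by (intro mult_left_mono) auto
    also have "\<dots> = ((r - 1) * Q0) * (l * mu)" by simp
    also have "\<dots> \<le> (4 * r * al * G) * (l * mu)"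
      using key l mu by (intro mult_right_mono) auto
    also have "\<dots> = (4 * r * l) * (al * G * mu)" by simp
    also have "\<dots> \<le> (d * (r - 1) / 10) * (al * G * mu)"
      using codegree_small(3)[OF r d dl] al G0 mu by (intro mult_right_mono) auto
    also have "\<dots> = (G * (r - 1)) * (al * d / 10 * mu)" by simp
    finally show ?thesis
      using G0 r by (subst (asm) mult_le_cancel_left_pos) auto
  qed
  have "((1 - al) * (d - l) - al * d / 10) * mu \<le> (1 - al) * ((d - l) * mu - l * X)"
    using lX by (simp add: algebra_simps)
  also have "\<dots> \<le> (1 - al) * ((p + l * c) * (mu + t))"
    using p(2) al by (intro mult_left_mono) (auto simp: t_def)
  also have "\<dots> = (p + l * c) * ((1 - al) * (mu + t))" by simp
  also have "\<dots> \<le> (p + l * c) * mu"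
    using B p(1) by (intro mult_left_mono)
  finally have low: "(1 - al) * (d - l) - al * d / 10 \<le> p + l * c"
    using mu by simp
  have "l * c \<le> l * (u * r)" using c l by (intro mult_left_mono)
  also have "\<dots> = u * (l * r)" by simp
  also have "\<dots> \<le> u * (d / 40)"
    using codegree_small(2)[OF r d dl] u by (intro mult_left_mono)
  finally have lc: "l * c \<le> u * (d / 40)" .
  have "(1 - al) * (d - 3/200 * d) \<le> (1 - al) * (d - l)"
    using codegree_small(1)[OF r d dl] al by (intro mult_left_mono) auto
  \<comment> \<open>The left-hand terms in \<open>al\<close> and \<open>u\<close> amount to
    \<open>(0.49675 - 0.1335 * u) * d\<close>; the constants of the claim are rounded so that the
    slack stays nonnegative up to \<open>u = 2\<close>.\<close>
  moreover have "(1 - al) * (d - 3/200 * d) - al * d / 10 - u * (d / 40)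
      - (49/100 - 133/1000 * u) * d = (27/4000 - u / 2000) * d"
    by (simp add: al_def field_simps)
  moreover have "(27/4000 - u / 2000) * d \<ge> 0"
    using u d by (intro mult_nonneg_nonneg) auto
  ultimately show ?thesis using low lc by linarith
qed

section \<open>Double counting under equal codegrees, and weight sums at a vertex\<close>

locale equal_codegree_hypergraph =
  fixes r lam :: nat and V :: "'a set" and E :: "'a set set"
  assumes uniform: "uniform_hypergraph r V E"
    and codegree_eq: "\<And>u v. u \<in> V \<Longrightarrow> v \<in> V \<Longrightarrow> u \<noteq> v \<Longrightarrow> codegree E u v = lam"
begin

lemma finite_V: "finite V"
  using uniform by (simp add: uniform_hypergraph_def)

lemma edge_subset: "e \<in> E \<Longrightarrow> e \<subseteq> V"
  using uniform by (simp add: uniform_hypergraph_def)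

lemma card_edge: "e \<in> E \<Longrightarrow> card e = r"
  using uniform by (simp add: uniform_hypergraph_def)

lemma finite_edge: "e \<in> E \<Longrightarrow> finite e"
  using edge_subset finite_V finite_subset by blast

lemma finite_E: "finite E"
  using edge_subset finite_V by (intro finite_subset[of E "Pow V"]) auto

text \<open>Exchanging the sums counts \<open>y u\<close> once for each edge through both
  \<open>v\<close> and \<open>u\<close>; for \<open>u = v\<close> this codegree is the
  degree.\<close>

lemma sum_edges_at:
  fixes y :: "'a \<Rightarrow> real"
  assumes "v \<in> V"
  shows "(\<Sum>f\<in>{e \<in> E. v \<in> e}. \<Sum>u\<in>f. y u) =
    real (degree E v) * y v + real lam * (\<Sum>u\<in>V - {v}. y u)"
proof -
  have "(\<Sum>f\<in>{e \<in> E. v \<in> e}. \<Sum>u\<in>f. y u) =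
      (\<Sum>f\<in>{e \<in> E. v \<in> e}. \<Sum>u\<in>{u \<in> V. u \<in> f}. y u)"
    by (intro sum.cong refl) (use edge_subset in auto)
  also have "\<dots> = (\<Sum>u\<in>V. \<Sum>f\<in>{f \<in> {e \<in> E. v \<in> e}. u \<in> f}. y u)"
    by (rule sum.swap_restrict) (use finite_E finite_V in auto)
  also have "\<dots> = (\<Sum>u\<in>V. real (codegree E v u) * y u)"
    by (simp add: codegree_def conj_assoc)
  also have "\<dots> = real (codegree E v v) * y v + (\<Sum>u\<in>V - {v}. real (codegree E v u) * y u)"
    using assms finite_V by (simp add: sum.remove)
  also have "(\<Sum>u\<in>V - {v}. real (codegree E v u) * y u) = real lam * (\<Sum>u\<in>V - {v}. y u)"
    unfolding sum_distrib_left using codegree_eq[OF assms] by (intro sum.cong) auto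
  finally show ?thesis
    by (simp add: codegree_def degree_def)
qed

text \<open>Constant weight \<open>1\<close> in \<open>sum_edges_at\<close> gives the block design
  identity; it makes the hypergraph regular once \<open>r \<ge> 2\<close>.\<close>

lemma degree_times:
  assumes "v \<in> V"
  shows "real (degree E v) * (real r - 1) = real lam * (real (card V) - 1)"
proof -
  have "card V > 0" using assms finite_V card_gt_0_iff by blast
  have "(\<Sum>f\<in>{e \<in> E. v \<in> e}. \<Sum>u\<in>f. 1::real) = real (degree E v) * real r"
    by (simp add: card_edge degree_def)
  with sum_edges_at[OF assms, of "\<lambda>_. 1"] assms finite_V \<open>card V > 0\<close> show ?thesis
    by (simp add: algebra_simps of_nat_diff card_Diff_singleton)
qed

lemma codegree_le_degree:
  assumes "v \<in> V" "card V > 10 * r ^ 3"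
  shows "10 * real lam * (real r)^3 \<le> real (degree E v) * (real r - 1)"
proof -
  \<comment> \<open>Strictness of the integer inequality absorbs the \<open>- 1\<close>.\<close>
  have "real (10 * r ^ 3) \<le> real (card V) - 1" using assms(2) by linarith
  then have "real lam * (10 * (real r)^3) \<le> real lam * (real (card V) - 1)"
    by (intro mult_left_mono) auto
  then show ?thesis using degree_times[OF assms(1)] by simp
qed

lemma card_edges_at_meeting:
  assumes "v \<in> V" "T \<subseteq> V" "v \<notin> T"
  shows "card {f \<in> E. v \<in> f \<and> f \<inter> T \<noteq> {}} \<le> lam * card T"
proof -
  have finT: "finite T" using assms finite_V finite_subset by blast
  have "{f \<in> E. v \<in> f \<and> f \<inter> T \<noteq> {}} = (\<Union>u\<in>T. {f \<in> E. v \<in> f \<and> u \<in> f})"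
    by auto
  then have "card {f \<in> E. v \<in> f \<and> f \<inter> T \<noteq> {}} \<le> (\<Sum>u\<in>T. card {f \<in> E. v \<in> f \<and> u \<in> f})"
    by (simp add: card_UN_le finT)
  also have "\<dots> = (\<Sum>u\<in>T. lam)"
    using assms codegree_eq by (intro sum.cong refl) (metis codegree_def subsetD)
  finally show ?thesis by (simp add: mult.commute)
qed

text \<open>When the vertices of \<open>T\<close> are added one at a time, the edges at the
  \<open>k+1\<close>-st overlap those already counted in at most \<open>lam * k\<close> edges, and
  \<open>0 + 1 + ... + (k - 1) \<le> k^2 / 2\<close>.\<close>

lemma sum_card_edges_at_le:
  assumes "Q \<subseteq> E" "T \<subseteq> V"
  shows "(\<Sum>v\<in>T. real (card {f \<in> Q. v \<in> f})) \<le> real (card Q) + real lam * (real (card T))\<^sup>2 / 2"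
proof -
  have finQ: "finite Q" using assms finite_E finite_subset by blast
  have "finite T" using assms finite_V finite_subset by blast
  then have "(\<Sum>v\<in>T. real (card {f \<in> Q. v \<in> f})) \<le>
      real (card {f \<in> Q. f \<inter> T \<noteq> {}}) + real lam * (real (card T))\<^sup>2 / 2"
    using assms(2)
  proof (induction T)
    case empty
    then show ?case by simp
  next
    case (insert v T)
    have "{f \<in> Q. v \<in> f} \<inter> {f \<in> Q. f \<inter> T \<noteq> {}} \<subseteq> {f \<in> E. v \<in> f \<and> f \<inter> T \<noteq> {}}"
      using assms(1) by auto
    then have "card ({f \<in> Q. v \<in> f} \<inter> {f \<in> Q. f \<inter> T \<noteq> {}}) \<le>
        card {f \<in> E. v \<in> f \<and> f \<inter> T \<noteq> {}}"
      using finite_E by (intro card_mono) auto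
    also have "\<dots> \<le> lam * card T"
      using insert.hyps insert.prems by (intro card_edges_at_meeting) auto
    finally have "card ({f \<in> Q. v \<in> f} \<inter> {f \<in> Q. f \<inter> T \<noteq> {}}) \<le> lam * card T" .
    moreover have "card {f \<in> Q. v \<in> f} + card {f \<in> Q. f \<inter> T \<noteq> {}} =
        card ({f \<in> Q. v \<in> f} \<union> {f \<in> Q. f \<inter> T \<noteq> {}}) +
        card ({f \<in> Q. v \<in> f} \<inter> {f \<in> Q. f \<inter> T \<noteq> {}})"
      using finQ by (intro card_Un_Int) auto
    moreover have "{f \<in> Q. v \<in> f} \<union> {f \<in> Q. f \<inter> T \<noteq> {}} = {f \<in> Q. f \<inter> insert v T \<noteq> {}}"
      by auto
    ultimately have "card {f \<in> Q. v \<in> f} + card {f \<in> Q. f \<inter> T \<noteq> {}} \<le>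
        card {f \<in> Q. f \<inter> insert v T \<noteq> {}} + lam * card T"
      by simp
    then have "real (card {f \<in> Q. v \<in> f}) + real (card {f \<in> Q. f \<inter> T \<noteq> {}}) \<le>
        real (card {f \<in> Q. f \<inter> insert v T \<noteq> {}}) + real lam * real (card T)"
      by (simp only: of_nat_add[symmetric] of_nat_mult[symmetric] of_nat_le_iff)
    then show ?case
      using insert by (simp add: power2_eq_square field_simps)
  qed
  moreover have "card {f \<in> Q. f \<inter> T \<noteq> {}} \<le> card Q"
    using finQ by (intro card_mono) auto
  ultimately show ?thesis by linarith
qed

text \<open>The weights on \<open>U\<close> are reset to \<open>0\<close>. The edges through \<open>v\<close> that then carry positive weight
  are nonnegative edges off \<open>U\<close> or meet \<open>U\<close>; each of them is bounded above by \<open>mu\<close> for \<open>v\<close>,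
  \<open>th\<close> for every other vertex outside \<open>T\<close>, and the actual weights on \<open>T\<close>.\<close>

lemma weight_bound_at:
  fixes w :: "'a \<Rightarrow> real"
  assumes v: "v \<in> V - U" and U: "U \<subseteq> V" and T: "T \<subseteq> V - U"
    and nonneg: "(\<Sum>u\<in>V - U. w u) \<ge> 0"
    and mu: "0 \<le> mu" "w v \<le> mu" and th: "0 \<le> th" "\<And>u. u \<in> V - U - T \<Longrightarrow> w u \<le> th"
    and r: "r \<ge> 1"
  shows "(real (degree E v) - real lam) * max 0 (w v) - real lam * (\<Sum>u\<in>T. max 0 (w u)) \<le>
    (real (card {f \<in> nonneg_edges E w. v \<in> f \<and> f \<inter> U = {}}) + real lam * real (card U)) *
      (mu + (real r - 1) * th)"
proof -
  define y where "y u = (if u \<in> U then 0 else w u)" for u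
  \<comment> \<open>Leaving out \<open>v\<close> removes the degree term when
    \<open>sum_edges_at\<close> is applied to \<open>z\<close>.\<close>
  define z where "z u = (if u \<in> T \<and> u \<noteq> v then max 0 (w u) else 0)" for u
  define X where "X = (\<Sum>u\<in>T. max 0 (w u))"
  define A where "A = {e \<in> E. v \<in> e}"
  define p where "p = card {f \<in> nonneg_edges E w. v \<in> f \<and> f \<inter> U = {}}"
  define F where "F = {f \<in> nonneg_edges E w. v \<in> f \<and> f \<inter> U = {}} \<union> {f \<in> E. v \<in> f \<and> f \<inter> U \<noteq> {}}"
  have vV: "v \<in> V" "v \<notin> U" using v by auto
  have finT: "finite T" using T finite_V finite_subset by blast
  have finA: "finite A" using finite_E by (simp add: A_def)
  have FA: "F \<subseteq> A" by (auto simp: F_def A_def nonneg_edges_def)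
  have y_sum: "(\<Sum>u\<in>V. y u) \<ge> 0"
  proof -
    have "(\<Sum>u\<in>V. y u) = (\<Sum>u\<in>V - U. y u)"
      using finite_V by (intro sum.mono_neutral_right) (auto simp: y_def)
    also have "\<dots> = (\<Sum>u\<in>V - U. w u)" by (intro sum.cong) (auto simp: y_def)
    finally show ?thesis using nonneg by simp
  qed
  have z_nonneg: "z u \<ge> 0" for u by (simp add: z_def)
  have z_sum: "(\<Sum>u\<in>V - {v}. z u) \<le> X"
  proof -
    have "(\<Sum>u\<in>V - {v}. z u) = (\<Sum>u\<in>T - {v}. z u)"
      using finite_V T by (intro sum.mono_neutral_right) (auto simp: z_def)
    also have "\<dots> \<le> (\<Sum>u\<in>T - {v}. max 0 (w u))"
      by (intro sum_mono) (auto simp: z_def)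
    also have "\<dots> \<le> X" unfolding X_def
      using finT by (intro sum_mono2) auto
    finally show ?thesis .
  qed
  have edge_le: "(\<Sum>u\<in>f. y u) \<le> mu + (real r - 1) * th + (\<Sum>u\<in>f. z u)" if "f \<in> A" for f
  proof -
    have f: "f \<in> E" "v \<in> f" using that by (auto simp: A_def)
    note fin = finite_edge[OF f(1)]
    have "(\<Sum>u\<in>f. y u) = y v + (\<Sum>u\<in>f - {v}. y u)"
      using fin f(2) by (simp add: sum.remove)
    also have "(\<Sum>u\<in>f - {v}. y u) \<le> (\<Sum>u\<in>f - {v}. th + z u)"
    proof (rule sum_mono)
      fix u assume "u \<in> f - {v}"
      then have u: "u \<in> V" "u \<noteq> v" using edge_subset[OF f(1)] by auto
      show "y u \<le> th + z u"
        using u th(1) th(2)[of u] by (auto simp: y_def z_def)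
    qed
    also have "\<dots> = (real r - 1) * th + (\<Sum>u\<in>f - {v}. z u)"
      using fin f r by (simp add: sum.distrib card_edge of_nat_diff)
    also have "(\<Sum>u\<in>f - {v}. z u) \<le> (\<Sum>u\<in>f. z u)"
      using fin z_nonneg by (intro sum_mono2) auto
    finally show ?thesis using mu vV by (simp add: y_def)
  qed
  have z_F: "(\<Sum>f\<in>F. \<Sum>u\<in>f. z u) \<le> real lam * X"
  proof -
    have "(\<Sum>f\<in>F. \<Sum>u\<in>f. z u) \<le> (\<Sum>f\<in>A. \<Sum>u\<in>f. z u)"
      using FA finA z_nonneg by (intro sum_mono2) (auto intro: sum_nonneg)
    also have "\<dots> = real lam * (\<Sum>u\<in>V - {v}. z u)"
      unfolding A_def using sum_edges_at[OF vV(1), of z] by (simp add: z_def)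
    also have "\<dots> \<le> real lam * X" using z_sum by (intro mult_left_mono) auto
    finally show ?thesis .
  qed
  have cardF: "card F \<le> p + lam * card U"
    unfolding F_def p_def
    using card_edges_at_meeting[OF vV(1) U vV(2)]
    by (intro order_trans[OF card_Un_le] add_left_mono)
  have "(real (degree E v) - real lam) * w v \<le>
      real (degree E v) * y v + real lam * (\<Sum>u\<in>V - {v}. y u)"
  proof -
    have "(\<Sum>u\<in>V. y u) = y v + (\<Sum>u\<in>V - {v}. y u)"
      using finite_V vV by (simp add: sum.remove)
    with y_sum have "real lam * (\<Sum>u\<in>V - {v}. y u) \<ge> real lam * (- y v)"
      by (intro mult_left_mono) auto
    then show ?thesis using vV by (simp add: y_def algebra_simps)
  qed
  also have "\<dots> = (\<Sum>f\<in>A. \<Sum>u\<in>f. y u)"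
    unfolding A_def by (rule sum_edges_at[OF vV(1), symmetric])
  also have "\<dots> = (\<Sum>f\<in>F. \<Sum>u\<in>f. y u) + (\<Sum>f\<in>A - F. \<Sum>u\<in>f. y u)"
    using FA finA by (metis add.commute sum.subset_diff)
  \<comment> \<open>An edge at \<open>v\<close> outside \<open>F\<close> avoids \<open>U\<close>, so
    the reset has not changed its negative weight.\<close>
  also have "(\<Sum>f\<in>A - F. \<Sum>u\<in>f. y u) \<le> 0"
  proof (rule sum_nonpos)
    fix f assume "f \<in> A - F"
    then have f: "f \<inter> U = {}" "(\<Sum>u\<in>f. w u) < 0"
      by (auto simp: A_def F_def nonneg_edges_def)
    then have "(\<Sum>u\<in>f. y u) = (\<Sum>u\<in>f. w u)"
      by (intro sum.cong) (auto simp: y_def)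
    then show "(\<Sum>u\<in>f. y u) \<le> 0" using f by simp
  qed
  also have "(\<Sum>f\<in>F. \<Sum>u\<in>f. y u) \<le> (\<Sum>f\<in>F. mu + (real r - 1) * th + (\<Sum>u\<in>f. z u))"
    using edge_le FA by (intro sum_mono) auto
  also have "\<dots> = real (card F) * (mu + (real r - 1) * th) + (\<Sum>f\<in>F. \<Sum>u\<in>f. z u)"
    by (simp add: sum.distrib)
  finally have main: "(real (degree E v) - real lam) * w v \<le>
      real (card F) * (mu + (real r - 1) * th) + real lam * X"
    using z_F by simp
  have X0: "X \<ge> 0" unfolding X_def by (intro sum_nonneg) auto
  have B0: "0 \<le> mu + (real r - 1) * th" using mu th r by simp
  have "real (card F) \<le> real p + real lam * real (card U)"
    using cardF by (simp only: of_nat_add[symmetric] of_nat_mult[symmetric] of_nat_le_iff)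
  then have "real (card F) * (mu + (real r - 1) * th) \<le>
      (real p + real lam * real (card U)) * (mu + (real r - 1) * th)"
    using B0 by (rule mult_right_mono)
  with main have pos: "(real (degree E v) - real lam) * w v \<le>
      (real p + real lam * real (card U)) * (mu + (real r - 1) * th) + real lam * X"
    by linarith
  \<comment> \<open>This is the claim for \<open>w v < 0\<close>. The form with \<open>max 0\<close>
    can then be summed over all of \<open>T\<close>, whatever the signs.\<close>
  have "(real p + real lam * real (card U)) * (mu + (real r - 1) * th) + real lam * X \<ge> 0"
    using B0 X0 by simp
  with pos show ?thesis
    unfolding X_def[symmetric] p_def[symmetric] by (cases "w v \<ge> 0") (auto simp: max_def)
qed

section \<open>Regularity, and nonnegative edges at a heaviest vertex\<close>

lemma degree_regular:
  assumes "u \<in> V" "v \<in> V" "r \<ge> 2"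
  shows "degree E u = degree E v"
proof -
  have "real (degree E u) * (real r - 1) = real (degree E v) * (real r - 1)"
    using assms degree_times by metis
  then show ?thesis using assms(3) by simp
qed

text \<open>Summing \<open>weight_bound_at\<close> over the \<open>4 * r\<close> heaviest vertices
  bounds their positive weight, because \<open>few\<close> and \<open>sum_card_edges_at_le\<close>
  limit the edges counted there; the same bound at \<open>v\<close> then gives the claim. In the
  applications \<open>U\<close> is a union of \<open>m\<close> negative edges.\<close>

lemma many_nonneg_edges_at_top:
  fixes w :: "'a \<Rightarrow> real"
  assumes r: "r \<ge> 2" and n: "card V > 10 * r ^ 3"
    and U: "U \<subseteq> V" "card U \<le> m * r" "m \<le> 2"
    and v: "v \<in> V - U" "\<And>u. u \<in> V - U \<Longrightarrow> w u \<le> w v" "w v > 0"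
    and nonneg: "(\<Sum>u\<in>V - U. w u) \<ge> 0"
    and deg: "degree E v > 0" and few: "card (nonneg_edges E w) \<le> degree E v"
  shows "(49/100 - 133/1000 * real m) * real (degree E v) \<le>
    real (card {f \<in> nonneg_edges E w. v \<in> f \<and> f \<inter> U = {}})"
proof -
  define p where "p u = real (card {f \<in> nonneg_edges E w. u \<in> f \<and> f \<inter> U = {}})" for u
  have finU: "finite U" using U finite_V finite_subset by blast
  have "4 * r \<le> card (V - U)"
  proof -
    have "r ^ 3 = r * r * r" by (simp add: power3_eq_cube)
    moreover have "r * r * r \<ge> 2 * 2 * r" using r by (intro mult_mono) auto
    moreover have "card U \<le> 2 * r" using U by (meson le_trans mult_le_mono1)
    ultimately show ?thesis
      using n card_Diff_subset[OF finU U(1)] by linarith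
  qed
  then obtain T where T: "T \<subseteq> V - U" "card T = 4 * r"
    "\<forall>t\<in>T. \<forall>a\<in>(V - U) - T. w a \<le> w t"
    using top_subset[of "V - U" "4 * r" w] finite_V by auto
  have finT: "finite T" using T(1) finite_V finite_subset by blast
  have T_ne: "T \<noteq> {}" using T(2) r by auto
  \<comment> \<open>Truncating at \<open>0\<close> keeps the threshold nonnegative even if
    \<open>T\<close> contains negative weights.\<close>
  define th where "th = max 0 (Min (w ` T))"
  define X where "X = (\<Sum>u\<in>T. max 0 (w u))"
  define B where "B = w v + (real r - 1) * th"
  have th0: "th \<ge> 0" by (simp add: th_def)
  have th_ge: "w u \<le> th" if "u \<in> V - U - T" for u
  proof -
    have "w u \<le> Min (w ` T)" using that T(3) T_ne finT by simp
    then show ?thesis by (simp add: th_def)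
  qed
  have X_ge: "X \<ge> 4 * real r * th"
  proof -
    have "th \<le> max 0 (w u)" if "u \<in> T" for u
      unfolding th_def using that finT by (intro max.mono) auto
    then have "real (card T) * th \<le> X"
      unfolding X_def by (intro sum_bounded_below)
    then show ?thesis by (simp add: T(2))
  qed
  have bound: "(real (degree E v) - real lam) * max 0 (w t) - real lam * X \<le>
      (p t + real lam * real (card U)) * B" if "t \<in> V - U" for t
  proof -
    have "degree E t = degree E v" using that v(1) r by (intro degree_regular) auto
    then show ?thesis
      using weight_bound_at[OF that U(1) T(1) nonneg _ v(2)[OF that] th0 th_ge] v(3) r
      by (simp add: p_def X_def B_def)
  qed
  define Q where "Q = (\<Sum>t\<in>T. p t) + 4 * real r * (real lam * real (card U))"
  have "(\<Sum>t\<in>T. (real (degree E v) - real lam) * max 0 (w t) - real lam * X) \<le>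
      (\<Sum>t\<in>T. (p t + real lam * real (card U)) * B)"
    using T(1) by (intro sum_mono bound) auto
  then have QX: "(real (degree E v) - real lam - 4 * real r * real lam) * X \<le> Q * B"
    by (simp add: sum_subtractf sum_distrib_left[symmetric] sum_distrib_right[symmetric]
        sum.distrib T(2) X_def[symmetric] Q_def algebra_simps)
  have "(\<Sum>t\<in>T. p t) \<le> real (card {f \<in> nonneg_edges E w. f \<inter> U = {}}) +
      real lam * (real (card T))\<^sup>2 / 2"
    using sum_card_edges_at_le[of "{f \<in> nonneg_edges E w. f \<inter> U = {}}" T] T(1)
    by (auto simp: p_def nonneg_edges_def conj_ac)
  moreover have "card {f \<in> nonneg_edges E w. f \<inter> U = {}} \<le> card (nonneg_edges E w)"
    using finite_E by (intro card_mono) (auto simp: nonneg_edges_def)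
  ultimately have p_sum: "(\<Sum>t\<in>T. p t) \<le> real (degree E v) + 8 * real lam * (real r)\<^sup>2"
    using few by (simp add: T(2) power2_eq_square)
  have Um: "real (card U) \<le> real m * real r"
    using U(2) by (simp only: of_nat_mult[symmetric] of_nat_le_iff)
  then have "4 * real r * (real lam * real (card U)) \<le> 4 * real r * (real lam * (real m * real r))"
    by (intro mult_left_mono) auto
  \<comment> \<open>Here \<open>8 * r^2\<close> is \<open>(4 * r)^2 / 2\<close> from the overlaps
    within \<open>T\<close>, and \<open>4 * m * r^2\<close> comes from \<open>4 * r\<close> vertices
    and \<open>card U \<le> m * r\<close>.\<close>
  with p_sum have Q_le:
    "Q \<le> real (degree E v) + real lam * (real r)\<^sup>2 * (8 + 4 * real m)"
    by (simp add: Q_def power2_eq_square algebra_simps)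
  have dn: "10 * real lam * (real r)^3 \<le> real (degree E v) * (real r - 1)"
    using codegree_le_degree[OF _ n] v(1) by simp
  show ?thesis
  proof (rule concentration_arith[where r = "real r" and l = "real lam" and u = "real m"
        and mu = "w v" and th = th and X = X and Q = Q and c = "real (card U)"])
    show "(real (degree E v) - real lam) * w v - real lam * X \<le>
        (real (card {f \<in> nonneg_edges E w. v \<in> f \<and> f \<inter> U = {}}) + real lam * real (card U)) *
          (w v + (real r - 1) * th)"
      using bound[OF v(1)] v(3) by (simp add: p_def B_def)
  qed (use r deg U(3) v(3) th0 X_ge QX Q_le dn Um in \<open>auto simp: B_def\<close>)
qed

section \<open>A heaviest vertex on a negative edge\<close>

text \<open>Deleting negative edges leaves positive total weight, so a heaviest remaining vertex has
  positive weight. Its nonnegative edges avoiding the deleted ones are disjoint from the families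
  found before, each of whose members contains a deleted vertex.\<close>

lemma negative_edge_at_top:
  fixes w :: "'a \<Rightarrow> real"
  assumes n: "card V > 10 * r ^ 3" and nonneg: "(\<Sum>u\<in>V. w u) \<ge> 0"
    and v: "v \<in> V" "\<And>u. u \<in> V \<Longrightarrow> w u \<le> w v"
    and e: "e \<in> E" "v \<in> e" "(\<Sum>u\<in>e. w u) < 0"
  shows "degree E v < card (nonneg_edges E w)"
proof (rule ccontr)
  assume "\<not> degree E v < card (nonneg_edges E w)"
  then have few: "card (nonneg_edges E w) \<le> degree E v" by simp
  define d where "d = real (degree E v)"
  have off_nonneg: "(\<Sum>u\<in>V - U. w u) > 0" if "U \<subseteq> V" "(\<Sum>u\<in>U. w u) < 0" for U
    using that nonneg finite_V sum.subset_diff[of U V w] by simp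
  have top: "\<exists>x\<in>V - U. w x > 0 \<and> (\<forall>u\<in>V - U. w u \<le> w x)"
    if U: "U \<subseteq> V" "(\<Sum>u\<in>U. w u) < 0" for U
  proof -
    have pos: "(\<Sum>u\<in>V - U. w u) > 0" by (rule off_nonneg[OF U])
    then have ne: "V - U \<noteq> {}" by (metis less_irrefl sum.empty)
    obtain x where x: "x \<in> V - U" "w x = Max (w ` (V - U))"
      using obtains_MAX[of "V - U" w] ne finite_V by (metis finite_Diff)
    have x_max: "w u \<le> w x" if "u \<in> V - U" for u
      using that finite_V x(2) by simp
    have "w x > 0"
    proof (rule ccontr)
      assume "\<not> w x > 0"
      then have "(\<Sum>u\<in>V - U. w u) \<le> 0"
        using x_max by (intro sum_nonpos) force
      with pos show False by simp
    qed
    with x x_max show ?thesis by blast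
  qed
  have eV: "e \<subseteq> V" using edge_subset e(1) by blast
  obtain x where x: "x \<in> V - e" "w x > 0" "\<And>u. u \<in> V - e \<Longrightarrow> w u \<le> w x"
    using top[OF eV e(3)] by auto
  have wv: "w v > 0" using x v(2)[of x] by auto
  \<comment> \<open>An edge \<open>{v}\<close> would have weight \<open>w v > 0\<close>, so
    \<open>r = 1\<close> is impossible here.\<close>
  have r: "r \<ge> 2"
  proof -
    have "r \<noteq> 0" using e card_edge[OF e(1)] finite_edge[OF e(1)] by (metis card_0_eq empty_iff)
    moreover have "r \<noteq> 1"
    proof
      assume "r = 1"
      then have "e = {v}" using card_edge[OF e(1)] e(2) by (metis card_1_singletonE singletonD)
      then show False using e(3) wv by simp
    qed
    ultimately show ?thesis by simp
  qed
  have deg: "degree E u = degree E v" if "u \<in> V" for u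
    using degree_regular[OF that v(1) r] .
  have "{f \<in> E. v \<in> f} \<noteq> {}" using e by auto
  then have deg0: "degree E v > 0"
    unfolding degree_def using finite_E by (simp add: card_gt_0_iff)
  then have d0: "d > 0" by (simp add: d_def)
  define N0 where "N0 = {f \<in> nonneg_edges E w. v \<in> f \<and> f \<inter> {} = {}}"
  define N1 where "N1 = {f \<in> nonneg_edges E w. x \<in> f \<and> f \<inter> e = {}}"
  have fin: "finite (nonneg_edges E w)" using finite_E by (simp add: nonneg_edges_def)
  have finN: "finite N0" "finite N1" using fin by (auto simp: N0_def N1_def)
  have N0: "49/100 * d \<le> real (card N0)"
    using many_nonneg_edges_at_top[OF r n, of "{}" 0 v w] v wv nonneg deg0 few
    by (simp add: N0_def d_def)
  have N01: "N0 \<inter> N1 = {}" using e(2) by (auto simp: N0_def N1_def)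
  show False
  proof (cases "\<exists>g\<in>E. x \<in> g \<and> g \<inter> e = {} \<and> (\<Sum>u\<in>g. w u) < 0")
    case True
    then obtain g where g: "g \<in> E" "x \<in> g" "g \<inter> e = {}" "(\<Sum>u\<in>g. w u) < 0" by auto
    have N1: "357/1000 * d \<le> real (card N1)"
      using many_nonneg_edges_at_top[OF r n eV, of 1 x w] x deg[of x] deg0 few
        card_edge[OF e(1)] off_nonneg[OF eV e(3)]
      by (simp add: N1_def d_def)
    have eg: "e \<union> g \<subseteq> V" using eV edge_subset[OF g(1)] by auto
    have eg_neg: "(\<Sum>u\<in>e \<union> g. w u) < 0"
      using e(3) g(3,4) finite_edge[OF e(1)] finite_edge[OF g(1)]
      by (subst sum.union_disjoint) auto
    obtain y where y: "y \<in> V - (e \<union> g)" "w y > 0" "\<And>u. u \<in> V - (e \<union> g) \<Longrightarrow> w u \<le> w y"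
      using top[OF eg eg_neg] by auto
    define N2 where "N2 = {f \<in> nonneg_edges E w. y \<in> f \<and> f \<inter> (e \<union> g) = {}}"
    have "card (e \<union> g) \<le> 2 * r"
      using card_Un_le[of e g] card_edge[OF e(1)] card_edge[OF g(1)] by simp
    then have N2: "224/1000 * d \<le> real (card N2)"
      using many_nonneg_edges_at_top[OF r n eg, of 2 y w] y deg[of y] deg0 few
        off_nonneg[OF eg eg_neg]
      by (simp add: N2_def d_def)
    have "card (N0 \<union> N1 \<union> N2) \<le> card (nonneg_edges E w)"
      using fin by (intro card_mono) (auto simp: N0_def N1_def N2_def)
    moreover have "card (N0 \<union> N1 \<union> N2) = card N0 + card N1 + card N2"
    proof -
      have "(N0 \<union> N1) \<inter> N2 = {}" using e(2) g(2) by (auto simp: N0_def N1_def N2_def)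
      moreover have "finite N2" using fin by (simp add: N2_def)
      ultimately show ?thesis using finN N01 by (simp add: card_Un_disjoint)
    qed
    ultimately show False using N0 N1 N2 few d0 unfolding d_def by linarith
  next
    case False
    \<comment> \<open>Every edge at \<open>x\<close> avoiding \<open>e\<close> is nonnegative now,
      so \<open>N1\<close> misses at most \<open>lam * r \<le> d / 40\<close> edges at
      \<open>x\<close>, and two families suffice.\<close>
    have "{f \<in> E. x \<in> f} \<subseteq> N1 \<union> {f \<in> E. x \<in> f \<and> f \<inter> e \<noteq> {}}"
      using False by (force simp: N1_def nonneg_edges_def)
    then have "card {f \<in> E. x \<in> f} \<le> card (N1 \<union> {f \<in> E. x \<in> f \<and> f \<inter> e \<noteq> {}})"
      using finN finite_E by (intro card_mono) auto
    also have "\<dots> \<le> card N1 + card {f \<in> E. x \<in> f \<and> f \<inter> e \<noteq> {}}"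
      by (rule card_Un_le)
    also have "\<dots> \<le> card N1 + lam * r"
      using card_edges_at_meeting[of x e] x eV card_edge[OF e(1)] by auto
    finally have "degree E v \<le> card N1 + lam * r"
      using deg[of x] x by (simp add: degree_def)
    then have N1: "d \<le> real (card N1) + real lam * real r"
      unfolding d_def by (simp only: of_nat_add[symmetric] of_nat_mult[symmetric] of_nat_le_iff)
    have "10 * real lam * (real r)^3 \<le> d * (real r - 1)"
      using codegree_le_degree[OF v(1) n] by (simp add: d_def)
    then have "real lam * real r \<le> d / 40"
      using codegree_small(2)[of "real r" d "real lam"] r d0 by simp
    moreover have "card (N0 \<union> N1) \<le> card (nonneg_edges E w)"
      using fin by (intro card_mono) (auto simp: N0_def N1_def)
    ultimately show False
      using N0 N1 few d0 card_Un_disjoint[OF finN N01] unfolding d_def by linarith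
  qed
qed

end

section \<open>The lower bound and the star in the case of equality\<close>

theorem theorem1p4:
  fixes r lam :: nat and V :: "'a set" and E :: "'a set set" and w :: "'a \<Rightarrow> real"
  assumes "r \<ge> 1"
    and "uniform_hypergraph r V E"
    and "card V > 10 * r ^ 3"
    and "\<forall>u\<in>V. \<forall>v\<in>V. u \<noteq> v \<longrightarrow> codegree E u v = lam"
    and "(\<Sum>v\<in>V. w v) \<ge> 0"
  shows "card (nonneg_edges E w) \<ge> min_degree V E \<and>
    (card (nonneg_edges E w) = min_degree V E \<longrightarrow>
      (\<exists>x\<in>V. \<forall>e\<in>nonneg_edges E w. x \<in> e))"
proof -
  interpret equal_codegree_hypergraph r lam V E
    using assms by unfold_locales auto
  have ne: "V \<noteq> {}" using assms(3) by auto
  then obtain v where v: "v \<in> V" "w v = Max (w ` V)"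
    using obtains_MAX[of V w] finite_V by metis
  have v_max: "w u \<le> w v" if "u \<in> V" for u using that finite_V v(2) by simp
  \<comment> \<open>An inequality is enough, which also covers \<open>r = 1\<close>, where degrees
    may differ.\<close>
  have min_le: "min_degree V E \<le> degree E v"
    unfolding min_degree_def using finite_V v(1) by simp
  have fin: "finite (nonneg_edges E w)" using finite_E by (simp add: nonneg_edges_def)
  show ?thesis
  proof (cases "\<exists>e\<in>E. v \<in> e \<and> (\<Sum>u\<in>e. w u) < 0")
    case True
    then have "degree E v < card (nonneg_edges E w)"
      using negative_edge_at_top[OF assms(3,5) v(1) v_max] by blast
    then show ?thesis using min_le by simp
  next
    case False
    then have sub: "{e \<in> E. v \<in> e} \<subseteq> nonneg_edges E w"
      by (force simp: nonneg_edges_def)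
    then have le: "degree E v \<le> card (nonneg_edges E w)"
      unfolding degree_def using fin by (rule card_mono[rotated])
    \<comment> \<open>Equality squeezes \<open>degree E v\<close> between two equal numbers, so the
      edges at \<open>v\<close> exhaust the nonnegative ones.\<close>
    have "\<forall>e\<in>nonneg_edges E w. v \<in> e" if "card (nonneg_edges E w) = min_degree V E"
    proof -
      have "card {e \<in> E. v \<in> e} = card (nonneg_edges E w)"
        using that le min_le by (simp add: degree_def)
      then have "{e \<in> E. v \<in> e} = nonneg_edges E w"
        using card_subset_eq[OF fin sub] by simp
      then show ?thesis by blast
    qed
    with v(1) le min_le show ?thesis by (meson le_trans)
  qed
qed

end
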